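(* Let $n\ge1$ be an integer and let $L_1,\dots,L_n,L_h,\lambda>0$ be real numbers. With $\lambda$ fixed, consider the following functions of the positive variables $(\ell_1,\dots,\ell_n,\ell_h)$ (batch size $B=1$ and uniform sampling $p_j=1/n$, $j=1,\dots,n$): $$\bar\eta(\ell_1,\dots,\ell_n,\ell_h)=\frac{2}{\left(\frac{2}{\lambda^2n}\sum_{i=1}^n\ell_i^2+1\right)\left(\frac1n\sum_{i=1}^n\ell_i+\ell_h+\lambda\right)},$$ $$\bar q(\ell_1,\dots,\ell_n,\ell_h)=\frac{4\lambda\left(\frac1n\sum_{i=1}^n\ell_i+\ell_h\right)}{\left(\frac{2}{\lambda^2n}\sum_{i=1}^n\ell_i^2+1\right)\left(\frac1n\sum_{i=1}^n\ell_i+\ell_h+\lambda\right)^2},$$ $$\tilde\eta(\ell_1,\dots,\ell_n,\ell_h)=\frac{1}{2\left(\max_{1\le i\le n}\ell_i+\ell_h\right)},\qquad \tilde q(\ell_1,\dots,\ell_n,\ell_h)=\frac{\lambda}{2\left(\max_{1\le i\le n}\ell_i+\ell_h\right)}.$$ Then for every constant $c$ with $0<c<\min\{L_1,\dots,L_n,L_h\}$, $$\bar\eta(L_1-c,\dots,L_n-c,L_h)>\bar\eta(L_1,\dots,L_n,L_h-c),$$ $$\bar q(L_1-c,\dots,L_n-c,L_h)>\bar q(L_1,\dots,L_n,L_h-c),$$ $$\tilde\eta(L_1-c,\dots,L_n-c,L_h)=\tilde\eta(L_1,\dots,L_n,L_h-c),$$ $$\tilde q(L_1-c,\dots,L_n-c,L_h)=\tilde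 q(L_1,\dots,L_n,L_h-c).$$
   Context: Here $L_i$ and $L_h$ play the role of the Lipschitz constants of $\nabla f_i$ and $\nabla h$, and $\lambda$ that of the strong convexity parameter of $\psi=\frac1n\sum_{i=1}^n f_i+h$. The pair $(\bar\eta,\bar q)$ gives the largest admissible step size and corresponding linear rate of one convergence analysis of SGD on $\psi$, and $(\tilde\eta,\tilde q)$ those of another. The claim itself involves only the explicit formulas given. *)

theory Defs
  imports Complex_Main
begin

text \<open>The variables \<open>\<ell>\<^sub>1, \<dots>, \<ell>\<^sub>n\<close> are the values at \<open>1, \<dots>, n\<close> of a function \<open>l :: nat \<Rightarrow> real\<close>,
  and \<open>lh\<close> is \<open>\<ell>\<^sub>h\<close>. The formulas are the ones for batch size 1 and uniform sampling;
  they are meaningful for \<open>n \<ge> 1\<close> and positive arguments only.\<close>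

definition eta_bar :: "nat \<Rightarrow> real \<Rightarrow> (nat \<Rightarrow> real) \<Rightarrow> real \<Rightarrow> real" where
  "eta_bar n lam l lh =
     2 / ((2 / (lam\<^sup>2 * real n) * (\<Sum>i=1..n. (l i)\<^sup>2) + 1)
          * (1 / real n * (\<Sum>i=1..n. l i) + lh + lam))"

definition q_bar :: "nat \<Rightarrow> real \<Rightarrow> (nat \<Rightarrow> real) \<Rightarrow> real \<Rightarrow> real" where
  "q_bar n lam l lh =
     4 * lam * (1 / real n * (\<Sum>i=1..n. l i) + lh)
     / ((2 / (lam\<^sup>2 * real n) * (\<Sum>i=1..n. (l i)\<^sup>2) + 1)
        * (1 / real n * (\<Sum>i=1..n. l i) + lh + lam)\<^sup>2)"

definition eta_tilde :: "nat \<Rightarrow> (nat \<Rightarrow> real) \<Rightarrow> real \<Rightarrow> real" where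
  "eta_tilde n l lh = 1 / (2 * (Max (l ` {1..n}) + lh))"

definition q_tilde :: "nat \<Rightarrow> real \<Rightarrow> (nat \<Rightarrow> real) \<Rightarrow> real \<Rightarrow> real" where
  "q_tilde n lam l lh = lam / (2 * (Max (l ` {1..n}) + lh))"

end

theory Submission
  imports Defs
begin

text \<open>The shift by \<open>c\<close> changes the mean of the \<open>\<ell>\<^sub>i\<close> and their maximum by \<open>c\<close>, so mean (or maximum)
  plus \<open>\<ell>\<^sub>h\<close> is the same on both sides. The only remaining dependence is on the sum of squares in the
  denominators, which is strictly smaller on the left because \<open>0 < L\<^sub>i - c < L\<^sub>i\<close>.\<close>

lemma mean_shift:
  fixes L :: "nat \<Rightarrow> real"
  assumes "n \<ge> 1"
  shows "1 / real n * (\<Sum>i=1..n. L i - c) = 1 / real n * (\<Sum>i=1..n. L i) - c"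
  using assms by (simp add: sum_subtractf field_simps)

lemma Max_shift:
  fixes L :: "nat \<Rightarrow> real"
  assumes "n \<ge> 1"
  shows "Max ((\<lambda>i. L i - c) ` {1..n}) = Max (L ` {1..n}) - c"
  using assms Max_add_commute[of "{1..n}" L "- c"] by simp

theorem theorem4p2:
  fixes n :: nat and L :: "nat \<Rightarrow> real" and Lh lam :: real
  assumes "n \<ge> 1"
    and "\<And>i. i \<in> {1..n} \<Longrightarrow> L i > 0"
    and "Lh > 0"
    and "lam > 0"
  shows "\<forall>c::real. 0 < c \<and> c < Min (insert Lh (L ` {1..n})) \<longrightarrow>
     eta_bar n lam (\<lambda>i. L i - c) Lh > eta_bar n lam L (Lh - c) \<and>
     q_bar n lam (\<lambda>i. L i - c) Lh > q_bar n lam L (Lh - c) \<and>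
     eta_tilde n (\<lambda>i. L i - c) Lh = eta_tilde n L (Lh - c) \<and>
     q_tilde n lam (\<lambda>i. L i - c) Lh = q_tilde n lam L (Lh - c)"
proof (intro allI impI, elim conjE)
  fix c :: real
  assume "0 < c" and "c < Min (insert Lh (L ` {1..n}))"
  then have ch: "c < Lh" and cL: "\<And>i. i \<in> {1..n} \<Longrightarrow> c < L i"
    by auto
  \<comment> \<open>Common value of mean plus \<open>lh\<close> at both arguments. In this form it
    is literally the right-hand one; the fact \<open>mean\<close> rewrites the left-hand one to it.
    \<open>A\<close> and \<open>B\<close> are the left and right sum-of-squares factors.\<close>
  define M where "M = 1 / real n * (\<Sum>i=1..n. L i) + (Lh - c)"
  define A where "A = 2 / (lam\<^sup>2 * real n) * (\<Sum>i=1..n. (L i - c)\<^sup>2) + 1"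
  define B where "B = 2 / (lam\<^sup>2 * real n) * (\<Sum>i=1..n. (L i)\<^sup>2) + 1"
  have "0 \<le> (\<Sum>i=1..n. L i)"
    using assms(2) by (intro sum_nonneg) (simp add: less_imp_le)
  with ch have M: "0 < M"
    unfolding M_def by (intro add_nonneg_pos) auto
  have A: "0 < A"
    unfolding A_def by (intro add_nonneg_pos mult_nonneg_nonneg sum_nonneg) auto
  \<comment> \<open>Squaring preserves \<open>L i - c < L i\<close> because \<open>c < L i\<close>
    keeps the smaller base positive; \<open>n \<ge> 1\<close> gives a nonempty index set, hence
    strictness.\<close>
  have "(\<Sum>i=1..n. (L i - c)\<^sup>2) < (\<Sum>i=1..n. (L i)\<^sup>2)"
  proof (rule sum_strict_mono)
    show "(L i - c)\<^sup>2 < (L i)\<^sup>2" if "i \<in> {1..n}" for i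
      using cL[OF that] \<open>0 < c\<close> by (intro power_strict_mono) auto
  qed (use assms(1) in auto)
  then have AB: "A < B"
    unfolding A_def B_def using assms(1,4)
    by (intro add_strict_right_mono mult_strict_left_mono) auto
  have mean: "1 / real n * (\<Sum>i=1..n. L i - c) + Lh = M"
    unfolding mean_shift[OF assms(1)] M_def by simp
  have "2 / (B * (M + lam)) < 2 / (A * (M + lam))"
    using A AB M assms(4) by (intro divide_strict_left_mono mult_strict_right_mono) auto
  then have "eta_bar n lam L (Lh - c) < eta_bar n lam (\<lambda>i. L i - c) Lh"
    unfolding eta_bar_def mean M_def[symmetric] A_def[symmetric] B_def[symmetric] .
  \<comment> \<open>Both numerators are the same \<open>4 * lam * M\<close>, positive by
    \<open>M\<close>, so again only \<open>A < B\<close> decides.\<close>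
  moreover have "4 * lam * M / (B * (M + lam)\<^sup>2) < 4 * lam * M / (A * (M + lam)\<^sup>2)"
    using A AB M assms(4) by (intro divide_strict_left_mono mult_strict_right_mono) auto
  then have "q_bar n lam L (Lh - c) < q_bar n lam (\<lambda>i. L i - c) Lh"
    unfolding q_bar_def mean M_def[symmetric] A_def[symmetric] B_def[symmetric] .
  ultimately show "eta_bar n lam (\<lambda>i. L i - c) Lh > eta_bar n lam L (Lh - c) \<and>
     q_bar n lam (\<lambda>i. L i - c) Lh > q_bar n lam L (Lh - c) \<and>
     eta_tilde n (\<lambda>i. L i - c) Lh = eta_tilde n L (Lh - c) \<and>
     q_tilde n lam (\<lambda>i. L i - c) Lh = q_tilde n lam L (Lh - c)"
    \<comment> \<open>No squares occur here: the \<open>- c\<close> merely moves from the maximum to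
      \<open>Lh\<close>, so the denominators coincide.\<close>
    unfolding eta_tilde_def q_tilde_def Max_shift[OF assms(1)]
    by (simp add: algebra_simps)
qed

end
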